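(* Let $H$ be a complex Hilbert space with $\dim(H)\ge 2$, let $\mathbf{G}\subseteq H$ be non-empty and let $\Theta\subseteq\mathbb{T}$ satisfy $|\Theta|=2$. Then $\mathbf{G}$ does $\Theta$-PR in $H$ if and only if $\mathbf{G}$ has the complement property.
   Context: $\mathbb{T}=\{z\in\mathbb{C}:|z|=1\}$. The inner product $\langle\cdot,\cdot\rangle$ is linear in the first and conjugate linear in the second argument. For $\Theta\subseteq\mathbb{T}$, a set $\mathbf{G}\subseteq H$ does $\Theta$-PR (in $H$) if for all $f,h\in H$ the following holds: if for every $g\in\mathbf{G}$ there exists $\theta_g\in\Theta$ with $\langle f,g\rangle=\theta_g\langle h,g\rangle$, then $f=\theta h$ for some $\theta\in\Theta$. A set $\mathbf{S}\subseteq H$ is complete in $H$ if the closure of its linear span is $H$ (equivalently, $\mathbf{S}^\perp=\{0\}$). $\mathbf{G}$ has the complement property if for every $\mathbf{S}\subseteq\mathbf{G}$, $\mathbf{S}$ is complete in $H$ or $\mathbf{G}\setminus\mathbf{S}$ is complete in $H$. *)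

theory Defs
  imports "HOL-Analysis.Analysis"
begin

text \<open>The metric and topology of a complex inner product space are those of the library's
  real normed vector spaces; the axiom \<open>scaleR_scaleC\<close> ties the underlying real
  vector space to the complex one.\<close>

class complex_inner = real_normed_vector +
  fixes scaleC :: "complex \<Rightarrow> 'a \<Rightarrow> 'a"  (infixr "*\<^sub>C" 75)
    and cinner :: "'a \<Rightarrow> 'a \<Rightarrow> complex"
  assumes scaleC_add_right: "c *\<^sub>C (x + y) = c *\<^sub>C x + c *\<^sub>C y"
    and scaleC_add_left: "(c + d) *\<^sub>C x = c *\<^sub>C x + d *\<^sub>C x"
    and scaleC_scaleC: "c *\<^sub>C (d *\<^sub>C x) = (c * d) *\<^sub>C x"
    and scaleC_one: "1 *\<^sub>C x = x"
    and scaleR_scaleC: "r *\<^sub>R x = complex_of_real r *\<^sub>C x"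
    and cinner_commute: "cinner x y = cnj (cinner y x)"
    and cinner_add_left: "cinner (x + y) z = cinner x z + cinner y z"
    and cinner_scaleC_left: "cinner (c *\<^sub>C x) y = c * cinner x y"
    and cinner_self_nonneg: "0 \<le> Re (cinner x x)"
    and cinner_eq_zero_iff: "cinner x x = 0 \<longleftrightarrow> x = 0"
    and norm_eq_sqrt_cinner: "norm x = sqrt (Re (cinner x x))"

class complex_hilbert_space = complex_inner + complete_space

global_interpretation complex_vector:
  vector_space "scaleC :: complex \<Rightarrow> 'a \<Rightarrow> 'a::complex_inner"
  by unfold_locales
    (rule scaleC_add_right scaleC_add_left scaleC_scaleC scaleC_one)+

text \<open>The library's \<open>dim\<close> is \<open>0\<close> on infinite-dimensional spaces, so a
  lower bound on the dimension is expressed through the cardinality of a basis.\<close>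

definition cdim_at_least :: "'a::complex_inner itself \<Rightarrow> nat \<Rightarrow> bool" where
  "cdim_at_least _ n \<longleftrightarrow>
    (\<exists>B :: 'a set. complex_vector.independent B \<and> complex_vector.span B = UNIV \<and>
       (infinite B \<or> n \<le> card B))"

definition does_PR :: "complex set \<Rightarrow> 'a::complex_inner set \<Rightarrow> bool" where
  "does_PR \<Theta> G \<longleftrightarrow>
    (\<forall>f h. (\<forall>g\<in>G. \<exists>\<theta>\<in>\<Theta>. cinner f g = \<theta> * cinner h g) \<longrightarrow>
       (\<exists>\<theta>\<in>\<Theta>. f = \<theta> *\<^sub>C h))"

definition complete_system :: "'a::complex_inner set \<Rightarrow> bool" where
  "complete_system S \<longleftrightarrow> closure (complex_vector.span S) = UNIV"

definition complement_property :: "'a::complex_inner set \<Rightarrow> bool" where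
  "complement_property G \<longleftrightarrow>
    (\<forall>S. S \<subseteq> G \<longrightarrow> complete_system S \<or> complete_system (G - S))"

end

theory Submission
  imports Defs
begin

text \<open>
  A set is complete iff only the zero vector is orthogonal to it. Write \<open>\<Theta> = {a, b}\<close>.
  Then \<open>\<langle>f, g\<rangle> \<in> {a\<langle>h, g\<rangle>, b\<langle>h, g\<rangle>}\<close> means that \<open>g\<close> is orthogonal to \<open>u = f - ah\<close> or to
  \<open>v = f - bh\<close>, and since \<open>a \<noteq> b\<close> the map from \<open>(f, h)\<close> to \<open>(u, v)\<close> is a bijection. So
  \<open>\<Theta>\<close>-PR says that whenever every \<open>g \<in> G\<close> is orthogonal to \<open>u\<close> or to \<open>v\<close>, one of the two
  vectors vanishes, which is the complement property.
\<close>

section \<open>Inner product identities\<close>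

lemma scaleC_minus_one: "(- 1) *\<^sub>C x = - x" for x :: "'a::complex_inner"
  by (metis complex_vector.scale_minus_left scaleC_one)

lemma cinner_minus_left: "cinner (- x) y = - cinner x y"
  by (metis cinner_scaleC_left mult_minus1 scaleC_minus_one)

lemma cinner_diff_left: "cinner (x - y) z = cinner x z - cinner y z"
  using cinner_add_left[of x "- y" z] by (simp add: cinner_minus_left)

lemma cinner_zero_left: "cinner 0 x = 0"
  using cinner_diff_left[of 0 0 x] by simp

lemma cinner_add_right: "cinner x (y + z) = cinner x y + cinner x z"
  by (metis cinner_add_left cinner_commute complex_cnj_add)

lemma cinner_scaleC_right: "cinner x (c *\<^sub>C y) = cnj c * cinner x y"
  by (metis cinner_commute cinner_scaleC_left complex_cnj_mult)

lemma cinner_minus_right: "cinner x (- y) = - cinner x y"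
  by (metis cinner_commute cinner_minus_left complex_cnj_minus)

lemma cinner_zero_right: "cinner x 0 = 0"
  by (metis cinner_commute cinner_zero_left complex_cnj_zero)

lemma power2_norm_eq_cinner: "(norm x)\<^sup>2 = Re (cinner x x)" for x :: "'a::complex_inner"
  by (simp add: norm_eq_sqrt_cinner cinner_self_nonneg)

lemma cinner_self: "cinner x x = complex_of_real ((norm x)\<^sup>2)" for x :: "'a::complex_inner"
  using cinner_commute[of x x] by (auto simp: complex_eq_iff power2_norm_eq_cinner)

lemma power2_norm_add:
  "(norm (x + y))\<^sup>2 = (norm x)\<^sup>2 + (norm y)\<^sup>2 + 2 * Re (cinner x y)"
  for x y :: "'a::complex_inner"
  using cinner_commute[of y x]
  by (simp add: power2_norm_eq_cinner cinner_add_left cinner_add_right)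

lemma power2_norm_diff:
  "(norm (x - y))\<^sup>2 = (norm x)\<^sup>2 + (norm y)\<^sup>2 - 2 * Re (cinner x y)"
  for x y :: "'a::complex_inner"
  using power2_norm_add[of x "- y"] by (simp add: cinner_minus_right)

lemma parallelogram_law:
  "(norm (x + y))\<^sup>2 + (norm (x - y))\<^sup>2 = 2 * (norm x)\<^sup>2 + 2 * (norm y)\<^sup>2"
  for x y :: "'a::complex_inner"
  by (simp add: power2_norm_add power2_norm_diff)

lemma cinner_eq_zero_span:
  assumes "\<And>g. g \<in> S \<Longrightarrow> cinner u g = 0" and "s \<in> complex_vector.span S"
  shows "cinner u s = 0"
  using assms(2)
  by (induction rule: complex_vector.span_induct_alt)
    (simp_all add: cinner_zero_right cinner_add_right cinner_scaleC_right assms(1))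

section \<open>Orthogonal vectors from minimal distance\<close>

text \<open>Subtracting from \<open>u\<close> its projection onto the line through \<open>m\<close>
  lowers the squared norm by |<u,m>|^2 / |m|^2, so minimality forces <u,m> = 0.\<close>

lemma cinner_eq_zero_if_minimal_norm:
  fixes u m :: "'a::complex_inner"
  assumes "\<And>c. norm u \<le> norm (u - c *\<^sub>C m)"
  shows "cinner u m = 0"
proof (cases "m = 0")
  case False
  \<comment> \<open>The coefficient of the orthogonal projection of \<open>u\<close> onto the line
    spanned by \<open>m\<close>.\<close>
  define c where "c = cinner u m / complex_of_real ((norm m)\<^sup>2)"
  have m: "(norm m)\<^sup>2 > 0"
    using False by simp
  have 1: "cinner u (c *\<^sub>C m) = complex_of_real ((cmod (cinner u m))\<^sup>2 / (norm m)\<^sup>2)"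
    unfolding c_def cinner_scaleC_right of_real_divide complex_norm_square by simp
  have "cinner (c *\<^sub>C m) (c *\<^sub>C m) = (c * cnj c) * cinner m m"
    by (simp add: cinner_scaleC_left cinner_scaleC_right)
  also have "\<dots> = complex_of_real ((cmod c)\<^sup>2 * (norm m)\<^sup>2)"
    by (simp only: cinner_self complex_norm_square[symmetric] of_real_mult)
  finally have "(norm (c *\<^sub>C m))\<^sup>2 = (cmod c)\<^sup>2 * (norm m)\<^sup>2"
    by (simp add: power2_norm_eq_cinner)
  also have "\<dots> = (cmod (cinner u m))\<^sup>2 / (norm m)\<^sup>2"
    using m by (simp add: c_def norm_divide power_divide field_simps norm_power)
  finally have 2: "(norm (c *\<^sub>C m))\<^sup>2 = (cmod (cinner u m))\<^sup>2 / (norm m)\<^sup>2" .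
  have "(norm u)\<^sup>2 \<le> (norm (u - c *\<^sub>C m))\<^sup>2"
    using assms by (simp add: power_mono)
  also have "\<dots> = (norm u)\<^sup>2 - (cmod (cinner u m))\<^sup>2 / (norm m)\<^sup>2"
    unfolding power2_norm_diff 1 2 by simp
  finally have "(cmod (cinner u m))\<^sup>2 \<le> 0"
    using m by (simp add: divide_le_0_iff)
  then show ?thesis
    by simp
qed (simp add: cinner_zero_right)

text \<open>By the parallelogram law, two vectors of norm close to \<open>d\<close> whose midpoint
  has norm at least \<open>d\<close> must be close to each other.\<close>

lemma minimizing_sequence_Cauchy:
  fixes u :: "nat \<Rightarrow> 'a::complex_inner"
  assumes mid: "\<And>m n. d \<le> norm ((1/2) *\<^sub>R (u m + u n))" and "0 \<le> d"
    and lim: "(\<lambda>n. norm (u n)) \<longlonglongrightarrow> d"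
  shows "Cauchy u"
proof (rule metric_CauchyI)
  fix e :: real assume "0 < e"
  have "(\<lambda>n. (norm (u n))\<^sup>2) \<longlonglongrightarrow> d\<^sup>2"
    using lim by (intro tendsto_intros)
  \<comment> \<open>The margin is chosen so that |u m - u n|^2 < 4 (d^2 + e^2/4) - 4 d^2 =
    e^2.\<close>
  moreover have "d\<^sup>2 < d\<^sup>2 + e\<^sup>2 / 4"
    using \<open>0 < e\<close> by simp
  ultimately have "eventually (\<lambda>n. (norm (u n))\<^sup>2 < d\<^sup>2 + e\<^sup>2 / 4) sequentially"
    by (rule order_tendstoD(2))
  then obtain N where N: "\<And>n. n \<ge> N \<Longrightarrow> (norm (u n))\<^sup>2 < d\<^sup>2 + e\<^sup>2 / 4"
    by (auto simp: eventually_sequentially)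
  have "dist (u m) (u n) < e" if "m \<ge> N" "n \<ge> N" for m n
  proof -
    have "2 * d \<le> norm (u m + u n)"
      using mid[of m n] by simp
    then have "(2 * d)\<^sup>2 \<le> (norm (u m + u n))\<^sup>2"
      using \<open>0 \<le> d\<close> by (intro power_mono) auto
    then have "(norm (u m - u n))\<^sup>2 < e\<^sup>2"
      using parallelogram_law[of "u m" "u n"] N[OF that(1)] N[OF that(2)]
      by (simp add: power_mult_distrib)
    then show ?thesis
      using \<open>0 < e\<close> by (simp add: dist_norm power_less_imp_less_base)
  qed
  then show "\<exists>N. \<forall>m\<ge>N. \<forall>n\<ge>N. dist (u m) (u n) < e"
    by blast
qed

text \<open>The existence half of the projection theorem. The vector sought is the limit of
  residuals \<open>x - y n\<close>, with \<open>y n\<close> in \<open>M\<close>, whose norms tend to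
  the distance from \<open>x\<close> to \<open>M\<close>. Since \<open>M\<close> need not be closed,
  this distance need not be attained in \<open>M\<close>.\<close>

lemma exists_orthogonal_if_not_in_closure:
  fixes M :: "'a::complex_hilbert_space set"
  assumes M: "complex_vector.subspace M" and x: "x \<notin> closure M"
  shows "\<exists>u. u \<noteq> 0 \<and> (\<forall>m\<in>M. cinner u m = 0)"
proof -
  define d where "d = infdist x M"
  have "0 \<in> M"
    using M by (rule complex_vector.subspace_0)
  then have "M \<noteq> {}"
    by blast
  then have "d > 0"
    using x in_closure_iff_infdist_zero[of M x] infdist_nonneg[of x M] by (simp add: d_def)
  have le: "d \<le> norm (x - y)" if "y \<in> M" for y
    using infdist_le[OF that, of x] by (simp add: d_def dist_norm)
  have "\<exists>y\<in>M. norm (x - y) < d + inverse (real (Suc n))" for n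
  proof (rule ccontr)
    assume "\<not> ?thesis"
    then have "d + inverse (real (Suc n)) \<le> infdist x M"
      using \<open>M \<noteq> {}\<close> unfolding infdist_notempty[OF \<open>M \<noteq> {}\<close>]
      by (intro cINF_greatest) (auto simp: dist_norm not_less)
    moreover have "inverse (real (Suc n)) > 0"
      by simp
    ultimately show False
      unfolding d_def by linarith
  qed
  then obtain y where y: "\<And>n. y n \<in> M" "\<And>n. norm (x - y n) < d + inverse (real (Suc n))"
    by metis
  define u where "u n = x - y n" for n
  have lim: "(\<lambda>n. norm (u n)) \<longlonglongrightarrow> d"
  proof (rule tendsto_sandwich)
    show "\<forall>\<^sub>F n in sequentially. d \<le> norm (u n)"
      using le y(1) by (simp add: u_def)
    show "\<forall>\<^sub>F n in sequentially. norm (u n) \<le> d + inverse (real (Suc n))"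
      using y(2) by (intro always_eventually allI less_imp_le) (simp only: u_def)
  qed (rule tendsto_const LIMSEQ_inverse_real_of_nat_add)+
  \<comment> \<open>The midpoint of two residuals is the residual of the midpoint of
    \<open>y m\<close> and \<open>y n\<close>, which lies in \<open>M\<close>.\<close>
  have mid: "d \<le> norm ((1/2) *\<^sub>R (u m + u n))" for m n
  proof -
    have "(1/2) *\<^sub>R (u m + u n) = (1/2) *\<^sub>R (x + x) - (1/2) *\<^sub>R (y m + y n)"
      by (simp add: u_def algebra_simps)
    also have "(1/2) *\<^sub>R (x + x) = x"
      by (simp flip: scaleR_2)
    finally have "(1/2) *\<^sub>R (u m + u n) = x - (1/2) *\<^sub>R (y m + y n)" .
    moreover have "(1/2) *\<^sub>R (y m + y n) \<in> M"
      unfolding scaleR_scaleC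
      by (intro complex_vector.subspace_scale[OF M] complex_vector.subspace_add[OF M] y)
    ultimately show ?thesis
      using le by simp
  qed
  have "Cauchy u"
    using mid _ lim by (rule minimizing_sequence_Cauchy) (use \<open>d > 0\<close> in simp)
  \<comment> \<open>Here the completeness of the Hilbert space enters.\<close>
  then obtain w where w: "u \<longlonglongrightarrow> w"
    using Cauchy_convergent convergent_def by blast
  have norm_w: "norm w = d"
    using LIMSEQ_unique[OF tendsto_norm[OF w] lim] .
  have "cinner w m = 0" if "m \<in> M" for m
  proof (rule cinner_eq_zero_if_minimal_norm)
    fix c
    have "(\<lambda>n. norm (u n - c *\<^sub>C m)) \<longlonglongrightarrow> norm (w - c *\<^sub>C m)"
      by (intro tendsto_intros w)
    \<comment> \<open>Subtracting a multiple of \<open>m\<close> from a residual gives the residual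
      of another point of \<open>M\<close>, so the bound \<open>d\<close> survives and passes to the
      limit.\<close>
    moreover have "d \<le> norm (u n - c *\<^sub>C m)" for n
    proof -
      have "y n + c *\<^sub>C m \<in> M"
        by (intro complex_vector.subspace_scale[OF M] complex_vector.subspace_add[OF M] y that)
      then show ?thesis
        using le by (simp add: u_def diff_diff_eq)
    qed
    ultimately show "norm w \<le> norm (w - c *\<^sub>C m)"
      unfolding norm_w by (intro LIMSEQ_le_const) auto
  qed
  moreover have "w \<noteq> 0"
    using norm_w \<open>d > 0\<close> by auto
  ultimately show ?thesis
    by blast
qed

section \<open>Completeness and the complement property through orthogonality\<close>

lemma complete_system_iff_orthogonal:
  fixes S :: "'a::complex_hilbert_space set"
  shows "complete_system S \<longleftrightarrow> (\<forall>u. (\<forall>g\<in>S. cinner u g = 0) \<longrightarrow> u = 0)"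
proof
  assume S: "complete_system S"
  show "\<forall>u. (\<forall>g\<in>S. cinner u g = 0) \<longrightarrow> u = 0"
  proof (intro allI impI, rule ccontr)
    fix u assume u: "\<forall>g\<in>S. cinner u g = 0" and "u \<noteq> 0"
    \<comment> \<open>Density gives some \<open>s\<close> in the span closer to \<open>u\<close>
      than 0 is. But \<open>s\<close> is orthogonal to \<open>u\<close>, so by Pythagoras it cannot
      be closer.\<close>
    have "u \<in> closure (complex_vector.span S)"
      using S by (simp add: complete_system_def)
    then obtain s where s: "s \<in> complex_vector.span S" "dist s u < norm u"
      using \<open>u \<noteq> 0\<close> closure_approachableD[of u _ "norm u"] by (auto simp: dist_commute)
    have "cinner u s = 0"
      by (rule cinner_eq_zero_span[OF _ s(1)]) (use u in blast)
    then have "(norm u)\<^sup>2 \<le> (norm (u - s))\<^sup>2"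
      by (simp add: power2_norm_diff)
    then have "norm u \<le> norm (u - s)"
      by (rule power2_le_imp_le) simp
    then show False
      using s(2) by (simp add: dist_norm norm_minus_commute)
  qed
next
  assume R: "\<forall>u. (\<forall>g\<in>S. cinner u g = 0) \<longrightarrow> u = 0"
  show "complete_system S"
  proof (rule ccontr)
    assume "\<not> complete_system S"
    then obtain x where "x \<notin> closure (complex_vector.span S)"
      by (auto simp: complete_system_def)
    then obtain u where "u \<noteq> 0" "\<forall>m\<in>complex_vector.span S. cinner u m = 0"
      using exists_orthogonal_if_not_in_closure[OF complex_vector.subspace_span[of S]] by auto
    then show False
      using R complex_vector.span_base[of _ S] by auto
  qed
qed

lemma complement_property_iff_orthogonal:
  fixes G :: "'a::complex_hilbert_space set"
  shows "complement_property G \<longleftrightarrow>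
    (\<forall>u v. (\<forall>g\<in>G. cinner u g = 0 \<or> cinner v g = 0) \<longrightarrow> u = 0 \<or> v = 0)"
proof
  assume G: "complement_property G"
  show "\<forall>u v. (\<forall>g\<in>G. cinner u g = 0 \<or> cinner v g = 0) \<longrightarrow> u = 0 \<or> v = 0"
  proof (intro allI impI)
    fix u v assume uv: "\<forall>g\<in>G. cinner u g = 0 \<or> cinner v g = 0"
    \<comment> \<open>Every element of \<open>G\<close> outside this set is orthogonal to
      \<open>v\<close>, so completeness of either half kills \<open>u\<close> or
      \<open>v\<close>.\<close>
    define S where "S = {g\<in>G. cinner u g = 0}"
    have "complete_system S \<or> complete_system (G - S)"
      using G by (simp add: complement_property_def S_def)
    then show "u = 0 \<or> v = 0"
      using uv unfolding complete_system_iff_orthogonal S_def by blast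
  qed
next
  assume R: "\<forall>u v. (\<forall>g\<in>G. cinner u g = 0 \<or> cinner v g = 0) \<longrightarrow> u = 0 \<or> v = 0"
  show "complement_property G"
    unfolding complement_property_def
  proof (intro allI impI, rule ccontr)
    fix S assume "S \<subseteq> G" "\<not> (complete_system S \<or> complete_system (G - S))"
    then obtain u v where "\<forall>g\<in>S. cinner u g = 0" "u \<noteq> 0" "\<forall>g\<in>G - S. cinner v g = 0" "v \<noteq> 0"
      unfolding complete_system_iff_orthogonal by blast
    then show False
      using R by blast
  qed
qed

section \<open>PR with two phases\<close>

lemma does_PR_pair_iff_orthogonal:
  fixes G :: "'a::complex_inner set"
  assumes "a \<noteq> b"
  shows "does_PR {a, b} G \<longleftrightarrow>
    (\<forall>u v. (\<forall>g\<in>G. cinner u g = 0 \<or> cinner v g = 0) \<longrightarrow> u = 0 \<or> v = 0)"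
    (is "_ \<longleftrightarrow> ?R")
proof -
  \<comment> \<open>Both the measurement condition and the conclusion on \<open>f\<close> and
    \<open>h\<close> now speak only of the two differences.\<close>
  have *: "does_PR {a, b} G \<longleftrightarrow> (\<forall>f h.
      (\<forall>g\<in>G. cinner (f - a *\<^sub>C h) g = 0 \<or> cinner (f - b *\<^sub>C h) g = 0) \<longrightarrow>
      f - a *\<^sub>C h = 0 \<or> f - b *\<^sub>C h = 0)"
    by (simp add: does_PR_def cinner_diff_left cinner_scaleC_left)
  show ?thesis
  proof
    assume PR: "does_PR {a, b} G"
    show ?R
    proof (intro allI impI)
      fix u v assume uv: "\<forall>g\<in>G. cinner u g = 0 \<or> cinner v g = 0"
      \<comment> \<open>Solving u = f - a h and v = f - b h: subtracting gives u - v = (b - a) h,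
        and then the first equation determines \<open>f\<close>.\<close>
      define h where "h = (1 / (b - a)) *\<^sub>C (u - v)"
      define f where "f = u + a *\<^sub>C h"
      have "b *\<^sub>C h - a *\<^sub>C h = ((b - a) * (1 / (b - a))) *\<^sub>C (u - v)"
        by (simp only: h_def scaleC_scaleC left_diff_distrib complex_vector.scale_left_diff_distrib)
      also have "\<dots> = u - v"
        using assms by (simp add: scaleC_one)
      finally have "v = u - (b *\<^sub>C h - a *\<^sub>C h)"
        by simp
      then have "f - a *\<^sub>C h = u" "f - b *\<^sub>C h = v"
        by (simp_all add: f_def)
      then show "u = 0 \<or> v = 0"
        using PR[unfolded *, rule_format, of f h] uv by simp
    qed
  next
    assume ?R
    then show "does_PR {a, b} G"
      unfolding * by blast
  qed
qed

theorem proposition1p2: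
  fixes G :: "'a::complex_hilbert_space set" and \<Theta> :: "complex set"
  assumes "cdim_at_least TYPE('a) 2"
    and "G \<noteq> {}"
    and "\<Theta> \<subseteq> sphere 0 1"
    and "card \<Theta> = 2"
  shows "does_PR \<Theta> G \<longleftrightarrow> complement_property G"
proof -
  obtain a b where "\<Theta> = {a, b}" "a \<noteq> b"
    using \<open>card \<Theta> = 2\<close> by (auto simp: card_2_iff)
  then show ?thesis
    by (simp add: does_PR_pair_iff_orthogonal complement_property_iff_orthogonal)
qed

end
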